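(* Let $P\subseteq Q\subseteq\{-1,1\}^k$ with $\operatorname{MAJ}\subseteq\operatorname{Pol}(P,Q)$. Let $(\mathbf v_0,\mathbf v_1,\dots,\mathbf v_k)$ be a $1-\gamma$ approximate vector assignment to $P$, and let $\epsilon>0$. Then for every $\mathbf b\in\{-1,1\}^k\setminus Q$, the probability that the $\epsilon$-CMM rounding applied to $(\mathbf v_0,\dots,\mathbf v_k)$ outputs $\mathbf b$ is at most $600k\,\frac{\max(\epsilon,\gamma)}{\sqrt\epsilon}$.
   Context: A function $f:\{-1,1\}^L\to\{-1,1\}$ is a polymorphism of $(P,Q)$ if for all $t^1,\dots,t^L\in P$ the tuple $(f(t^1_i,\dots,t^L_i))_{i\in[k]}$ lies in $Q$. $\operatorname{MAJ}\subseteq\operatorname{Pol}(P,Q)$ means that for every odd $L$ the majority function $\operatorname{MAJ}_L$ (value $1$ if $\sum_i x_i\ge0$, else $-1$) is such a polymorphism. A tuple $(\mathbf v_0,\mathbf v_1,\dots,\mathbf v_k)$ of vectors in $\mathbb R^N$ with $\mathbf v_0$ a unit vector is a $1-\gamma$ approximate vector assignment to $P$ if there is a probability distribution $\mu$ on $\{-1,1\}^k$ such that: - $\mu(P)\ge1-\gamma$; - $\langle\mathbf v_0,\mathbf v_i\rangle=\sum_{\mathbf a}a_i\mu(\mathbf a)$ for all $i\in[k]$; - $\langle\mathbf v_i,\mathbf v_{i'}\rangle=\sum_{\mathbf a}a_ia_{i'}\mu(\mathbf a)$ for all $i,i'\in[k]$. The $\epsilon$-CMM rounding samples a standard Gaussian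 vector $\vec r\sim\mathcal N(0_N,I_N)$ and outputs $\mathbf b'\in\{-1,1\}^k$, where $b'_i=1$ if $\langle\mathbf v_i,\mathbf v_0+\sqrt\epsilon\,\vec r\rangle\ge0$ and $b'_i=-1$ otherwise. *)

theory Defs
  imports "HOL-Probability.Probability"
begin

text \<open>
  Boolean values are the reals \<open>-1\<close> and \<open>1\<close>.  The index set \<open>[k]\<close> is a finite type \<open>'k\<close>, so
  \<open>k = CARD('k)\<close> and \<open>k \<ge> 1\<close>.  Since the arity \<open>L\<close> of a polymorphism is quantified over, points of
  \<open>{-1,1}^L\<close> are extensional functions on \<open>{..<L}\<close>.
\<close>

definition cube :: "('k \<Rightarrow> real) set" where
  "cube = {a. \<forall>i. a i \<in> {-1, 1}}"

definition polymorphisms ::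
    "nat \<Rightarrow> ('k \<Rightarrow> real) set \<Rightarrow> ('k \<Rightarrow> real) set \<Rightarrow> ((nat \<Rightarrow> real) \<Rightarrow> real) set" where
  "polymorphisms L P Q =
     {f. f \<in> ({..<L} \<rightarrow>\<^sub>E {-1, 1}) \<rightarrow> {-1, 1} \<and>
         (\<forall>t :: nat \<Rightarrow> 'k \<Rightarrow> real. (\<forall>j<L. t j \<in> P) \<longrightarrow> (\<lambda>i. f (\<lambda>j\<in>{..<L}. t j i)) \<in> Q)}"

definition maj :: "nat \<Rightarrow> (nat \<Rightarrow> real) \<Rightarrow> real" where
  "maj L x = (if (\<Sum>j<L. x j) \<ge> 0 then 1 else -1)"

definition maj_subset_pol :: "('k \<Rightarrow> real) set \<Rightarrow> ('k \<Rightarrow> real) set \<Rightarrow> bool" where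
  "maj_subset_pol P Q \<longleftrightarrow> (\<forall>L. odd L \<longrightarrow> maj L \<in> polymorphisms L P Q)"

text \<open>
  \<open>approx_vector_assignment \<gamma> P v0 v\<close> says that \<open>(v0, (v i)\<^sub>i)\<close> is a \<open>1 - \<gamma>\<close> approximate vector
  assignment to \<open>P\<close>.
\<close>

definition approx_vector_assignment ::
    "real \<Rightarrow> ('k::finite \<Rightarrow> real) set \<Rightarrow> real ^ 'n \<Rightarrow> ('k \<Rightarrow> real ^ 'n) \<Rightarrow> bool" where
  "approx_vector_assignment \<gamma> P v0 v \<longleftrightarrow>
     norm v0 = 1 \<and>
     (\<exists>\<mu> :: ('k \<Rightarrow> real) pmf.
        set_pmf \<mu> \<subseteq> cube \<and>
        measure_pmf.prob \<mu> P \<ge> 1 - \<gamma> \<and>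
        (\<forall>i. v0 \<bullet> v i = (\<Sum>a\<in>cube. a i * pmf \<mu> a)) \<and>
        (\<forall>i i'. v i \<bullet> v i' = (\<Sum>a\<in>cube. a i * a i' * pmf \<mu> a)))"

text \<open>The law of a vector whose coordinates are independent \<open>N(0,1)\<close> variables.\<close>

definition std_gaussian :: "(real ^ 'n) measure" where
  "std_gaussian =
     distr (PiM (UNIV :: 'n set) (\<lambda>_. density lborel std_normal_density)) borel (\<lambda>x. \<chi> i. x i)"

definition cmm_round ::
    "real \<Rightarrow> real ^ 'n \<Rightarrow> ('k \<Rightarrow> real ^ 'n) \<Rightarrow> real ^ 'n \<Rightarrow> ('k \<Rightarrow> real)" where
  "cmm_round \<epsilon> v0 v r = (\<lambda>i. if v i \<bullet> (v0 + sqrt \<epsilon> *\<^sub>R r) \<ge> 0 then 1 else -1)"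

definition cmm_prob ::
    "real \<Rightarrow> real ^ 'n \<Rightarrow> ('k \<Rightarrow> real ^ 'n) \<Rightarrow> ('k \<Rightarrow> real) \<Rightarrow> real" where
  "cmm_prob \<epsilon> v0 v b = measure std_gaussian {r. cmm_round \<epsilon> v0 v r = b}"

text \<open>
  The sums over \<^const>\<open>cube\<close> are finite, and \<^const>\<open>cmm_prob\<close> is the probability of a measurable
  event, so neither takes a default value.
\<close>

lemma finite_cube: "finite (cube :: ('k::finite \<Rightarrow> real) set)"
proof -
  have "cube = (UNIV :: 'k set) \<rightarrow>\<^sub>E {-1, 1 :: real}"
    by (auto simp: cube_def PiE_def extensional_def)
  then show ?thesis
    using finite_PiE[of "UNIV :: 'k set" "\<lambda>_. {-1, 1 :: real}"] by simp
qed

lemma measurable_vec_lambda [measurable]: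
  "(\<lambda>x. \<chi> i. x i) \<in>
     PiM (UNIV :: 'n::finite set) (\<lambda>_. density lborel std_normal_density) \<rightarrow>\<^sub>M borel"
proof -
  have "(\<lambda>x. (\<chi> i. x i) \<bullet> b) \<in>
      borel_measurable (PiM (UNIV :: 'n set) (\<lambda>_. density lborel std_normal_density))"
    if "b \<in> Basis" for b :: "real ^ 'n"
    unfolding inner_vec_def vec_lambda_beta by measurable
  then show ?thesis
    by (subst borel_measurable_euclidean_space) blast
qed

lemma sets_std_gaussian [simp, measurable_cong]: "sets std_gaussian = sets borel"
  by (simp add: std_gaussian_def)

lemma prob_space_std_gaussian: "prob_space (std_gaussian :: (real ^ 'n) measure)"
proof -
  have "prob_space (PiM (UNIV :: 'n set) (\<lambda>_. density lborel std_normal_density))"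
    by (intro prob_space_PiM prob_space_normal_density) simp
  then show ?thesis
    unfolding std_gaussian_def by (rule prob_space.prob_space_distr) measurable
qed

lemma cmm_event_measurable:
  fixes v :: "'k::finite \<Rightarrow> real ^ 'n"
  shows "{r. cmm_round \<epsilon> v0 v r = b} \<in> sets std_gaussian"
proof -
  have "{r \<in> space borel. \<forall>i. (if v i \<bullet> (v0 + sqrt \<epsilon> *\<^sub>R r) \<ge> 0 then 1 else -1) = b i}
      \<in> sets borel"
    by measurable
  then show ?thesis
    by (simp add: cmm_round_def fun_eq_iff)
qed

end

(*
  If some distribution on P had a mean with strict sign pattern b, a large majority would output b;
  so for b outside Q a separating hyperplane gives weights w >= 0 of total mass 1 with
  sum_i w_i b_i a_i <= 0 for all a in P.  Put W = sum_i w_i b_i v_i.  The functional a |-> sum_i w_i b_i a_i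
  has values in [-1,1] and is positive only off P, whence <W,v0> + |W|^2 <= 2 gamma.

  Let g = v0 + sqrt eps r.  If the rounding outputs b, all numbers b_i <v_i,g> are nonnegative, and their
  average with weights w is <W,g>.  For an index with w_i >= 1/k this puts b_i <v_i,g> in [0, k <W,g>].
  With M = max eps gamma and n = floor(<W,g>/M), the Gaussian <v_i,r> lies in an interval of length
  k (n+1) M / sqrt eps while <W,g> >= n M.  These two events are correlated; the exponential weight in
  Chernoff's bound for the second one only shifts the Gaussian, so the joint probability is at most
  exp (2 - n) times the length of the interval.  Summing over n gives the bound.
*)

theory Submission
  imports Defs
begin

section \<open>Majority polymorphisms and separating weights\<close>

text \<open>Majority is applied to a list of points, so integer weights have to become repetitions.
  A single list serves every \<open>f\<close>, hence all coordinates are read off the same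
  list.\<close>

lemma list_with_multiplicities:
  assumes "finite A"
  obtains xs where "set xs \<subseteq> A"
    and "\<And>f :: 'a \<Rightarrow> real. sum_list (map f xs) = (\<Sum>a\<in>A. real (n a) * f a)"
proof -
  have "\<exists>xs. set xs \<subseteq> A \<and> (\<forall>f :: 'a \<Rightarrow> real. sum_list (map f xs) = (\<Sum>a\<in>A. real (n a) * f a))"
    using assms
  proof (induction A rule: finite_induct)
    case (insert a A)
    then obtain xs where xs: "set xs \<subseteq> A"
      "\<forall>f :: 'a \<Rightarrow> real. sum_list (map f xs) = (\<Sum>a\<in>A. real (n a) * f a)"
      by blast
    show ?case
      using xs insert.hyps
      by (intro exI[of _ "replicate (n a) a @ xs"]) (auto simp: sum_list_replicate)
  qed simp
  then show ?thesis
    using that by blast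
qed

lemma real_sum_list_nth: "(\<Sum>j<length xs. f (xs ! j)) = sum_list (map f xs)"
  by (simp add: sum_list_sum_nth atLeast0LessThan)

text \<open>At coordinate \<open>i\<close>, majority returns the sign of the sum of the entries. The
  hypothesis \<open>pos\<close> makes this sign \<open>b i\<close>, so the polymorphism maps the
  list to exactly \<open>b\<close>.\<close>

lemma maj_polymorphism_sign:
  fixes P Q :: "('k \<Rightarrow> real) set"
  assumes maj: "maj_subset_pol P Q" and b: "b \<in> cube" and odd: "odd (length xs)"
    and xs: "set xs \<subseteq> P" and pos: "\<And>i. b i * sum_list (map (\<lambda>a. a i) xs) > 0"
  shows "b \<in> Q"
proof -
  let ?L = "length xs"
  have "(\<lambda>i. maj ?L (\<lambda>j\<in>{..<?L}. (xs ! j) i)) \<in> Q"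
  proof -
    have "maj ?L \<in> polymorphisms ?L P Q"
      using maj odd by (auto simp: maj_subset_pol_def)
    then have "\<forall>t. (\<forall>j<?L. t j \<in> P) \<longrightarrow> (\<lambda>i. maj ?L (\<lambda>j\<in>{..<?L}. t j i)) \<in> Q"
      by (simp add: polymorphisms_def)
    then show ?thesis
      using xs by (elim allE[of _ "\<lambda>j. xs ! j"]) auto
  qed
  moreover have "maj ?L (\<lambda>j\<in>{..<?L}. (xs ! j) i) = b i" for i
  proof -
    have "(\<Sum>j<?L. (\<lambda>j\<in>{..<?L}. (xs ! j) i) j) = sum_list (map (\<lambda>a. a i) xs)"
      by (simp add: real_sum_list_nth[of "\<lambda>a. a i"])
    moreover have "b i = 1 \<or> b i = -1"
      using b by (auto simp: cube_def)
    ultimately show ?thesis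
      using pos[of i] by (auto simp: maj_def simp del: restrict_apply)
  qed
  ultimately show ?thesis
    by simp
qed

text \<open>Rounding the weights of a convex combination to integer multiplicities costs at most one per
  point, and one more point makes their number odd.\<close>

lemma maj_polymorphism_mean_sign:
  fixes P Q :: "('k::finite \<Rightarrow> real) set"
  assumes maj: "maj_subset_pol P Q" and b: "b \<in> cube" and P: "P \<subseteq> cube"
    and p: "\<And>a. a \<in> P \<Longrightarrow> p a \<ge> 0"
    and pos: "\<And>i. (\<Sum>a\<in>P. p a * (b i * a i)) > 0"
  shows "b \<in> Q"
proof -
  have fin: "finite P"
    using P finite_cube by (rule finite_subset)
  have bnd: "\<bar>b i * a i\<bar> \<le> 1" if "a \<in> P" for a i
  proof -
    have "b i = 1 \<or> b i = -1" "a i = 1 \<or> a i = -1"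
      using b P that by (auto simp: cube_def)
    then show ?thesis by auto
  qed
  \<comment> \<open>There are finitely many coordinates, so their margins have a positive minimum
    and one scaling factor \<open>N\<close> works for all of them.\<close>
  define \<delta> where "\<delta> = Min (range (\<lambda>i. \<Sum>a\<in>P. p a * (b i * a i)))"
  have \<delta>: "\<delta> > 0" "\<delta> \<le> (\<Sum>a\<in>P. p a * (b i * a i))" for i
    using pos by (auto simp: \<delta>_def)
  \<comment> \<open>Rounding loses at most \<open>card P\<close> in each signed coordinate sum; the
    extra 1 pays for the point that may be added to fix parity.\<close>
  obtain N :: nat where N: "real N * \<delta> > real (card P) + 1"
    using reals_Archimedean3[OF \<delta>(1)] by blast
  define n where "n a = nat \<lfloor>real N * p a\<rfloor>" for a
  obtain xs where xs: "set xs \<subseteq> P"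
    "\<And>f :: _ \<Rightarrow> real. sum_list (map f xs) = (\<Sum>a\<in>P. real (n a) * f a)"
    using list_with_multiplicities[OF fin] by blast
  have large: "sum_list (map (\<lambda>a. b i * a i) xs) > 1" for i
  proof -
    have "\<bar>(real N * p a - real (n a)) * (b i * a i)\<bar> \<le> 1" if "a \<in> P" for a
    proof -
      have "\<bar>real N * p a - real (n a)\<bar> \<le> 1"
        using p[OF that] unfolding n_def by (simp add: abs_le_iff) linarith
      then show ?thesis
        using bnd[OF that, of i] unfolding abs_mult[of "real N * p a - real (n a)"]
        by (intro mult_le_one) auto
    qed
    then have "(\<Sum>a\<in>P. (real N * p a - real (n a)) * (b i * a i)) \<le> (\<Sum>a\<in>P. 1)"
      by (intro sum_mono) (auto dest: abs_le_D1)
    moreover have "(\<Sum>a\<in>P. (real N * p a - real (n a)) * (b i * a i))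
        = real N * (\<Sum>a\<in>P. p a * (b i * a i)) - sum_list (map (\<lambda>a. b i * a i) xs)"
      by (simp add: xs(2) left_diff_distrib sum_subtractf sum_distrib_left mult.assoc)
    moreover have "real N * \<delta> \<le> real N * (\<Sum>a\<in>P. p a * (b i * a i))"
      by (intro mult_left_mono \<delta>) simp
    ultimately show ?thesis
      using N by simp
  qed
  have "xs \<noteq> []"
    using large by force
  then have hd: "hd xs \<in> P"
    using xs(1) by (auto dest: hd_in_set)
  \<comment> \<open>The signed sums exceed 1 and a further point of \<open>P\<close> contributes at
    least -1 to each, so they stay positive.\<close>
  define ys where "ys = (if odd (length xs) then xs else hd xs # xs)"
  show ?thesis
  proof (rule maj_polymorphism_sign[OF maj b])
    show "odd (length ys)" "set ys \<subseteq> P"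
      using hd xs(1) by (auto simp: ys_def)
    show "b i * sum_list (map (\<lambda>a. a i) ys) > 0" for i
      using large[of i] bnd[OF hd, of i] by (auto simp: ys_def sum_list_const_mult ring_distribs)
  qed
qed

text \<open>After coordinatewise multiplication by \<open>b\<close>, the strict sign pattern
  \<open>b\<close> becomes the open positive orthant. The convex hull of the transformed
  \<open>P\<close> misses it, since otherwise the preceding lemma puts \<open>b\<close> in
  \<open>Q\<close>. The normal of a separating hyperplane, scaled to total mass 1, gives the
  weights.\<close>

lemma separating_weights:
  fixes P Q :: "('k::finite \<Rightarrow> real) set"
  assumes maj: "maj_subset_pol P Q" and b: "b \<in> cube - Q" and P: "P \<subseteq> cube"
  obtains w where "\<And>i. w i \<ge> 0" and "(\<Sum>i\<in>UNIV. w i) = 1"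
    and "\<And>a. a \<in> P \<Longrightarrow> (\<Sum>i\<in>UNIV. w i * (b i * a i)) \<le> 0"
proof (cases "P = {}")
  case True
  show ?thesis
    \<comment> \<open>Separation needs a nonempty hull; if \<open>P\<close> is empty, any
      probability weights will do, for instance the uniform ones.\<close>
    by (rule that[of "\<lambda>_. 1 / real CARD('k)"]) (use True in auto)
next
  case False
  have fin: "finite P"
    using P finite_cube by (rule finite_subset)
  define g :: "('k \<Rightarrow> real) \<Rightarrow> real ^ 'k" where "g a = (\<chi> i. b i * a i)" for a
  define S where "S = convex hull (g ` P)"
  define T :: "(real ^ 'k) set" where "T = {x. \<forall>i. x $ i > 0}"
  \<comment> \<open>The entries of \<open>b\<close> are nonzero. Injectivity lets convex weights on
    the image of \<open>P\<close> be pulled back to \<open>P\<close>.\<close>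
  have injg: "inj_on g P"
    using b by (auto simp: inj_on_def g_def vec_eq_iff cube_def fun_eq_iff) (metis mult_cancel_left zero_neq_neg_one zero_neq_one)
  have "S \<inter> T = {}"
  proof (rule ccontr)
    assume "S \<inter> T \<noteq> {}"
    then obtain q where q: "\<forall>x\<in>g ` P. 0 \<le> q x" "(\<Sum>x\<in>g ` P. q x *\<^sub>R x) \<in> T"
      using fin by (auto simp: S_def convex_hull_finite)
    have "b \<in> Q"
    proof (rule maj_polymorphism_mean_sign[OF maj _ P, where p = "q \<circ> g"])
      show "0 < (\<Sum>a\<in>P. (q \<circ> g) a * (b i * a i))" for i
      proof -
        have "(\<Sum>x\<in>g ` P. q x *\<^sub>R x) $ i = (\<Sum>a\<in>P. (q \<circ> g) a * (b i * a i))"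
          by (subst sum.reindex[OF injg]) (simp add: g_def)
        moreover have "(\<Sum>x\<in>g ` P. q x *\<^sub>R x) $ i > 0"
          using q(2) unfolding T_def by blast
        ultimately show ?thesis
          by (simp only:)
      qed
    qed (use b q in auto)
    then show False
      using b by simp
  qed
  moreover have "convex T"
  proof -
    have "T = (\<Inter>i. {x. axis i 1 \<bullet> x > 0})"
      by (auto simp: T_def inner_axis')
    then show ?thesis
      by (simp add: convex_INT convex_halfspace_gt)
  qed
  moreover have "vec 1 \<in> T"
    by (simp add: T_def)
  moreover have "convex S" "S \<noteq> {}"
    using False by (auto simp: S_def convex_convex_hull)
  ultimately obtain y c where y: "y \<noteq> 0" "\<forall>x\<in>S. y \<bullet> x \<le> c" "\<forall>x\<in>T. y \<bullet> x \<ge> c"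
    using separating_hyperplane_sets[of S T] by blast
  \<comment> \<open>The next steps evaluate \<open>y\<close> at 0 and on coordinate axes, which lie
    only in the closure of \<open>T\<close>. A small multiple of the all-ones vector pushes such
    points into \<open>T\<close>.\<close>
  have closure: "y \<bullet> x \<ge> c" if "\<And>i. x $ i \<ge> 0" for x
  proof (rule field_le_epsilon)
    fix e :: real assume "e > 0"
    define d where "d = e / (\<bar>y \<bullet> vec 1\<bar> + 1)"
    have d: "d > 0" "d * (y \<bullet> vec 1) \<le> e"
    proof -
      show "d > 0" using \<open>e > 0\<close> by (simp add: d_def)
      have "d * (y \<bullet> vec 1) \<le> d * (\<bar>y \<bullet> vec 1\<bar> + 1)"
        using \<open>d > 0\<close> by (intro mult_left_mono) auto
      then show "d * (y \<bullet> vec 1) \<le> e"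
        by (simp add: d_def)
    qed
    have "x + d *\<^sub>R vec 1 \<in> T"
      using that d by (auto simp: T_def intro: add_nonneg_pos)
    then have "c \<le> y \<bullet> (x + d *\<^sub>R vec 1)"
      using y(3) by blast
    also have "\<dots> \<le> y \<bullet> x + e"
      using d by (simp add: inner_add_right)
    finally show "c \<le> y \<bullet> x + e" .
  qed
  have "c \<le> 0"
    using closure[of 0] by simp
  have ynn: "y $ i \<ge> 0" for i
  proof (rule ccontr)
    assume neg: "\<not> y $ i \<ge> 0"
    \<comment> \<open>If \<open>y $ i\<close> were negative, \<open>y\<close> would be unbounded
      below along this axis. The multiple is nonnegative because \<open>c \<le> 0\<close>, and it is
      chosen so that the value is \<open>c - 1\<close>.\<close>
    have "c \<le> y \<bullet> (((c - 1) / y $ i) *\<^sub>R axis i 1)"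
      using neg \<open>c \<le> 0\<close> by (intro closure) (auto simp: axis_def divide_nonpos_neg intro!: divide_nonpos_neg)
    also have "\<dots> = c - 1"
      using neg by (simp add: inner_axis)
    finally show False by simp
  qed
  define s where "s = (\<Sum>i\<in>UNIV. y $ i)"
  have "s > 0"
  proof -
    obtain i where "y $ i \<noteq> 0"
      using y(1) by (auto simp: vec_eq_iff)
    then have "y $ i > 0"
      using ynn[of i] by simp
    then show ?thesis
      unfolding s_def using ynn by (intro sum_pos2[of UNIV i]) auto
  qed
  show ?thesis
  proof (rule that[of "\<lambda>i. y $ i / s"])
    show "y $ i / s \<ge> 0" for i
      using ynn \<open>s > 0\<close> by simp
    show "(\<Sum>i\<in>UNIV. y $ i / s) = 1"
      using \<open>s > 0\<close> by (simp add: s_def flip: sum_divide_distrib)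
    fix a assume "a \<in> P"
    then have "y \<bullet> g a \<le> c"
      using y(2) by (auto simp: S_def hull_inc)
    then have "(\<Sum>i\<in>UNIV. y $ i * (b i * a i)) \<le> 0"
      using \<open>c \<le> 0\<close> by (simp add: inner_vec_def g_def)
    then show "(\<Sum>i\<in>UNIV. y $ i / s * (b i * a i)) \<le> 0"
      using \<open>s > 0\<close> by (simp add: divide_nonpos_pos flip: sum_divide_distrib)
  qed
qed

section \<open>Exponential tilting of Gaussian vectors\<close>

abbreviation normal_vector :: "('n \<Rightarrow> real) \<Rightarrow> ('n \<Rightarrow> real) measure" where
  "normal_vector a \<equiv> PiM UNIV (\<lambda>j. density lborel (normal_density (a j) 1))"

text \<open>This is the finite-dimensional Cameron-Martin formula. In each coordinate it is a
  completion of the square, and boxes determine the product measure.\<close>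

lemma std_gaussian_tilt:
  fixes a :: "'n::finite \<Rightarrow> real"
  shows "density (normal_vector (\<lambda>_. 0)) (\<lambda>x. \<Prod>j\<in>UNIV. ennreal (exp (a j * x j - (a j)\<^sup>2 / 2)))
    = normal_vector a" (is "density ?N ?f = _")
proof -
  have ps: "product_sigma_finite (\<lambda>j. density lborel (normal_density (c j) 1))" for c :: "'n \<Rightarrow> real"
    by (intro product_sigma_finite.intro prob_space_imp_sigma_finite prob_space_normal_density) simp
  interpret N: product_sigma_finite "\<lambda>_::'n. density lborel std_normal_density"
    using ps[of "\<lambda>_. 0"] .
  interpret K: product_sigma_finite "\<lambda>j. density lborel (normal_density (a j) 1)"
    by (rule ps)
  show ?thesis
  proof (rule K.PiM_eqI)
    show "sets (density ?N ?f) = sets (normal_vector a)"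
      by (simp cong: sets_PiM_cong)
  next
    fix A :: "'n \<Rightarrow> real set"
    assume "\<And>i. i \<in> UNIV \<Longrightarrow> A i \<in> sets (density lborel (normal_density (a i) 1))"
    then have A [measurable]: "A i \<in> sets borel" for i
      by simp
    have "emeasure (density ?N ?f) (Pi\<^sub>E UNIV A)
        = (\<integral>\<^sup>+ x. ?f x * indicator (Pi\<^sub>E UNIV A) x \<partial>?N)"
      by (rule emeasure_density) (auto intro!: sets_PiM_I_finite)
    also have "\<dots> = (\<integral>\<^sup>+ x. (\<Prod>j\<in>UNIV. ennreal (exp (a j * x j - (a j)\<^sup>2 / 2)) * indicator (A j) (x j)) \<partial>?N)"
      by (intro nn_integral_cong) (auto simp: prod.distrib indicator_def PiE_def Pi_def)
    also have "\<dots> = (\<Prod>j\<in>UNIV. \<integral>\<^sup>+ y. ennreal (exp (a j * y - (a j)\<^sup>2 / 2)) * indicator (A j) y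
                        \<partial>density lborel std_normal_density)"
      by (rule N.product_nn_integral_prod) auto
    also have "\<dots> = (\<Prod>j\<in>UNIV. emeasure (density lborel (normal_density (a j) 1)) (A j))"
    proof (intro prod.cong refl)
      fix j
      have "normal_density (a j) 1 y = std_normal_density y * exp (a j * y - (a j)\<^sup>2 / 2)" for y
        by (simp add: normal_density_def power2_eq_square field_simps flip: exp_add)
      then show "(\<integral>\<^sup>+ y. ennreal (exp (a j * y - (a j)\<^sup>2 / 2)) * indicator (A j) y
            \<partial>density lborel std_normal_density) = emeasure (density lborel (normal_density (a j) 1)) (A j)"
        by (simp add: nn_integral_density emeasure_density ennreal_mult' mult.assoc)
    qed
    finally show "emeasure (density ?N ?f) (Pi\<^sub>E UNIV A)
        = (\<Prod>j\<in>UNIV. emeasure (density lborel (normal_density (a j) 1)) (A j))" .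
  qed simp
qed

text \<open>The coordinates are independent normals, so a linear combination is normal, its means
  and variances adding up; the variances sum to 1.\<close>

lemma normal_vector_inner_distributed:
  fixes a u :: "'n::finite \<Rightarrow> real"
  assumes u: "(\<Sum>j\<in>UNIV. (u j)\<^sup>2) = 1"
  shows "distributed (normal_vector a) lborel (\<lambda>x. \<Sum>j\<in>UNIV. u j * x j)
           (normal_density (\<Sum>j\<in>UNIV. u j * a j) 1)"
proof -
  let ?M = "\<lambda>j. density lborel (normal_density (a j) 1)"
  \<comment> \<open>A coordinate with zero coefficient would contribute a constant, which has no
    normal density. These coordinates are dropped, and some remain because \<open>u\<close> is not
    0.\<close>
  let ?J = "{j. u j \<noteq> 0}"
  have pj: "prob_space (?M j)" for j
    by (rule prob_space_normal_density) simp
  interpret prob_space "normal_vector a"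
    by (rule prob_space_PiM) (rule pj)
  have comp: "distr (normal_vector a) borel (\<lambda>x. x j) = ?M j" for j
  proof -
    have "distr (normal_vector a) borel (\<lambda>x. x j) = distr (normal_vector a) (?M j) (\<lambda>x. x j)"
      by (rule distr_cong) auto
    also have "\<dots> = ?M j"
      by (rule distr_PiM_component) (auto intro: pj)
    finally show ?thesis .
  qed
  have dist: "distributed (normal_vector a) lborel (\<lambda>x. x j) (normal_density (a j) 1)" for j
  proof -
    have "distr (normal_vector a) lborel (\<lambda>x. x j) = distr (normal_vector a) borel (\<lambda>x. x j)"
      by (rule distr_cong) auto
    then show ?thesis
      by (auto simp: distributed_def comp)
  qed
  have "indep_vars (\<lambda>_. borel) (\<lambda>j x. x j) UNIV"
  proof (subst indep_vars_iff_distr_eq_PiM')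
    have "distr (normal_vector a) (PiM UNIV (\<lambda>_. borel)) (\<lambda>x. x) = distr (normal_vector a) (normal_vector a) (\<lambda>x. x)"
      by (rule distr_cong) (auto cong: sets_PiM_cong)
    then show "distr (normal_vector a) (PiM UNIV (\<lambda>_. borel)) (\<lambda>x. \<lambda>i\<in>UNIV. x i)
        = PiM UNIV (\<lambda>i. distr (normal_vector a) borel (\<lambda>x. x i))"
      by (simp add: comp restrict_def)
  qed auto
  then have ind: "indep_vars (\<lambda>_. borel) (\<lambda>j x. u j * x j) ?J"
    by (rule indep_vars_compose2[where X = "\<lambda>j x. x j", OF indep_vars_subset]) auto
  have sum_J: "(\<Sum>j\<in>?J. u j * y j) = (\<Sum>j\<in>UNIV. u j * y j)" for y
    by (rule sum.mono_neutral_left) auto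
  have nz: "?J \<noteq> {}"
    using u by force
  have "distributed (normal_vector a) lborel (\<lambda>x. \<Sum>j\<in>?J. u j * x j)
          (normal_density (\<Sum>j\<in>?J. u j * a j) (sqrt (\<Sum>j\<in>?J. \<bar>u j\<bar>\<^sup>2)))"
  proof (rule sum_indep_normal[OF _ nz ind])
    fix j assume "j \<in> ?J"
    then show "distributed (normal_vector a) lborel (\<lambda>x. u j * x j) (normal_density (u j * a j) \<bar>u j\<bar>)"
      using normal_density_affine[OF dist[of j], of "u j" 0] by simp
  qed auto
  moreover have "(\<Sum>j\<in>?J. \<bar>u j\<bar>\<^sup>2) = 1"
    using sum_J[of u] u by (simp add: power2_eq_square)
  ultimately show ?thesis
    by (simp add: sum_J)
qed

text \<open>The weight moves the mean of the Gaussian to \<open>a\<close>, at the price of the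
  factor \<open>exp ((norm a)\<^sup>2 / 2)\<close>. The projection to \<open>u\<close> still has
  variance 1, so its density is at most 1 wherever its mean lies, and the strip has mass at most its
  width.\<close>

lemma std_gaussian_exp_strip:
  fixes a u :: "real ^ 'n"
  assumes u: "norm u = 1" and cd: "c \<le> d"
  shows "(\<integral>\<^sup>+ r. ennreal (exp (a \<bullet> r)) * indicator {r. c \<le> u \<bullet> r \<and> u \<bullet> r \<le> d} r \<partial>std_gaussian)
           \<le> ennreal (exp ((norm a)\<^sup>2 / 2) * (d - c))"
proof -
  let ?N = "normal_vector (\<lambda>_::'n. 0)" and ?K = "normal_vector (\<lambda>j. a $ j)"
  let ?h = "\<lambda>x. \<Sum>j\<in>UNIV. u $ j * x j"
  let ?f = "\<lambda>x. \<Prod>j\<in>UNIV. ennreal (exp (a $ j * x j - (a $ j)\<^sup>2 / 2))"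
  have na: "(norm a)\<^sup>2 = (\<Sum>j\<in>UNIV. (a $ j)\<^sup>2)" and nu: "(norm u)\<^sup>2 = (\<Sum>j\<in>UNIV. (u $ j)\<^sup>2)"
    by (simp_all add: norm_vec_def L2_set_def sum_nonneg)
  have dist: "distributed ?K lborel ?h (normal_density (\<Sum>j\<in>UNIV. u $ j * a $ j) 1)"
    using normal_vector_inner_distributed[of "\<lambda>j. u $ j" "\<lambda>j. a $ j"] u nu by simp
  have tilt: "ennreal (exp (a \<bullet> (\<chi> j. x j))) = ennreal (exp ((norm a)\<^sup>2 / 2)) * ?f x" for x
    by (simp add: na inner_vec_def prod_ennreal exp_sum[symmetric] sum_subtractf sum_divide_distrib
        flip: ennreal_mult' exp_add)
  have "(\<integral>\<^sup>+ r. ennreal (exp (a \<bullet> r)) * indicator {r. c \<le> u \<bullet> r \<and> u \<bullet> r \<le> d} r \<partial>std_gaussian)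
      = (\<integral>\<^sup>+ x. ennreal (exp (a \<bullet> (\<chi> j. x j))) * indicator {r. c \<le> u \<bullet> r \<and> u \<bullet> r \<le> d} (\<chi> j. x j) \<partial>?N)"
    unfolding std_gaussian_def by (rule nn_integral_distr) measurable
  also have "\<dots> = (\<integral>\<^sup>+ x. ennreal (exp ((norm a)\<^sup>2 / 2)) * (?f x * indicator {c..d} (?h x)) \<partial>?N)"
    unfolding tilt by (intro nn_integral_cong) (simp add: inner_vec_def indicator_def mult.assoc)
  also have "\<dots> = ennreal (exp ((norm a)\<^sup>2 / 2)) * (\<integral>\<^sup>+ x. ?f x * indicator {c..d} (?h x) \<partial>?N)"
    by (rule nn_integral_cmult) measurable
  also have "(\<integral>\<^sup>+ x. ?f x * indicator {c..d} (?h x) \<partial>?N) = (\<integral>\<^sup>+ x. indicator {c..d} (?h x) \<partial>density ?N ?f)"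
    by (rule nn_integral_density[symmetric]) measurable
  also have "\<dots> = (\<integral>\<^sup>+ x. indicator {c..d} (?h x) \<partial>?K)"
    by (simp only: std_gaussian_tilt)
  also have "\<dots> = (\<integral>\<^sup>+ y. ennreal (normal_density (\<Sum>j\<in>UNIV. u $ j * a $ j) 1 y) * indicator {c..d} y \<partial>lborel)"
    by (rule distributed_nn_integral[OF dist, symmetric]) measurable
  also have "\<dots> \<le> (\<integral>\<^sup>+ y. indicator {c..d} y \<partial>lborel)"
  proof (intro nn_integral_mono)
    fix y :: real
    \<comment> \<open>The density is at most \<open>1 / sqrt (2 * pi)\<close>; the cruder bound 1
      suffices.\<close>
    have "exp (- (y - z)\<^sup>2 / 2) \<le> 1" "1 \<le> sqrt (2 * pi)" for z :: real
      using pi_gt3 by auto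
    then have "exp (- (y - z)\<^sup>2 / 2) \<le> sqrt (2 * pi)" for z
      by (rule order_trans)
    then have "normal_density z 1 y \<le> 1" for z
      by (simp add: normal_density_def divide_le_eq)
    then show "ennreal (normal_density (\<Sum>j\<in>UNIV. u $ j * a $ j) 1 y) * indicator {c..d} y \<le> indicator {c..d} y"
      by (auto simp: indicator_def)
  qed
  also have "\<dots> = ennreal (d - c)"
    using cd by simp
  finally show ?thesis
    using cd by (simp add: ennreal_mult mult_left_mono)
qed

section \<open>From a vector assignment to a Gaussian level estimate\<close>

text \<open>Under \<mu> the functional \<open>s\<close> has mean \<open>?W \<bullet> v0\<close> and
  second moment \<open>(norm ?W)\<^sup>2\<close>, so the left side is the expectation of
  \<open>s + s\<^sup>2\<close>. This is nonpositive for \<open>-1 \<le> s \<le> 0\<close>, which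
  covers the support inside \<open>P\<close>, and at most 2 on the rest, whose mass is at most
  \<gamma>.\<close>

lemma approx_vector_assignment_functional:
  fixes v :: "'k::finite \<Rightarrow> real ^ 'n" and y :: "'k \<Rightarrow> real"
  assumes ava: "approx_vector_assignment \<gamma> P v0 v"
    and y: "(\<Sum>i\<in>UNIV. \<bar>y i\<bar>) \<le> 1"
    and P: "\<And>a. a \<in> P \<Longrightarrow> (\<Sum>i\<in>UNIV. y i * a i) \<le> 0"
  shows "(\<Sum>i\<in>UNIV. y i *\<^sub>R v i) \<bullet> v0 + (norm (\<Sum>i\<in>UNIV. y i *\<^sub>R v i))\<^sup>2 \<le> 2 * \<gamma>"
proof -
  obtain \<mu> :: "('k \<Rightarrow> real) pmf" where sub: "set_pmf \<mu> \<subseteq> cube"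
    and \<mu>P: "measure_pmf.prob \<mu> P \<ge> 1 - \<gamma>"
    and m1: "\<And>i. v0 \<bullet> v i = (\<Sum>a\<in>cube. a i * pmf \<mu> a)"
    and m2: "\<And>i i'. v i \<bullet> v i' = (\<Sum>a\<in>cube. a i * a i' * pmf \<mu> a)"
    using ava unfolding approx_vector_assignment_def by blast
  define s where "s a = (\<Sum>i\<in>UNIV. y i * a i)" for a
  let ?W = "\<Sum>i\<in>UNIV. y i *\<^sub>R v i"
  have s_le: "\<bar>s a\<bar> \<le> 1" if "a \<in> cube" for a
  proof -
    have "\<bar>s a\<bar> \<le> (\<Sum>i\<in>UNIV. \<bar>y i * a i\<bar>)"
      unfolding s_def by (rule sum_abs)
    also have "\<dots> = (\<Sum>i\<in>UNIV. \<bar>y i\<bar>)"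
    proof (intro sum.cong refl)
      fix i
      show "\<bar>y i * a i\<bar> = \<bar>y i\<bar>"
        using that by (auto simp: cube_def abs_mult dest!: spec[of _ i])
    qed
    finally show ?thesis
      using y by simp
  qed
  have "?W \<bullet> v0 = (\<Sum>i\<in>UNIV. \<Sum>a\<in>cube. y i * a i * pmf \<mu> a)"
    by (subst inner_commute) (simp add: inner_sum_right m1 sum_distrib_left mult.assoc)
  also have "\<dots> = (\<Sum>a\<in>cube. s a * pmf \<mu> a)"
    by (subst sum.swap) (simp add: s_def sum_distrib_right)
  finally have mean: "?W \<bullet> v0 = (\<Sum>a\<in>cube. s a * pmf \<mu> a)" .
  have "(norm ?W)\<^sup>2 = (\<Sum>i\<in>UNIV. \<Sum>j\<in>UNIV. \<Sum>a\<in>cube. (y i * a i) * (y j * a j) * pmf \<mu> a)"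
    by (simp add: power2_norm_eq_inner inner_sum_left inner_sum_right m2 sum_distrib_left mult_ac)
  also have "\<dots> = (\<Sum>a\<in>cube. \<Sum>i\<in>UNIV. \<Sum>j\<in>UNIV. (y i * a i) * (y j * a j) * pmf \<mu> a)"
  proof -
    have "(\<Sum>i\<in>UNIV. \<Sum>j\<in>UNIV. \<Sum>a\<in>cube. (y i * a i) * (y j * a j) * pmf \<mu> a)
        = (\<Sum>i\<in>UNIV. \<Sum>a\<in>cube. \<Sum>j\<in>UNIV. (y i * a i) * (y j * a j) * pmf \<mu> a)"
      by (intro sum.cong refl sum.swap)
    also have "\<dots> = (\<Sum>a\<in>cube. \<Sum>i\<in>UNIV. \<Sum>j\<in>UNIV. (y i * a i) * (y j * a j) * pmf \<mu> a)"
      by (rule sum.swap)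
    finally show ?thesis .
  qed
  also have "\<dots> = (\<Sum>a\<in>cube. (s a)\<^sup>2 * pmf \<mu> a)"
  proof -
    have "(s a)\<^sup>2 = (\<Sum>i\<in>UNIV. \<Sum>j\<in>UNIV. (y i * a i) * (y j * a j))" for a
      by (simp only: s_def power2_eq_square sum_product)
    then show ?thesis
      by (simp only: sum_distrib_right)
  qed
  finally have "?W \<bullet> v0 + (norm ?W)\<^sup>2 = (\<Sum>a\<in>cube. (s a + (s a)\<^sup>2) * pmf \<mu> a)"
    by (simp add: mean ring_distribs sum.distrib)
  also have "\<dots> \<le> (\<Sum>a\<in>cube. 2 * (if a \<in> - P then pmf \<mu> a else 0))"
  proof (rule sum_mono)
    fix a :: "'k \<Rightarrow> real" assume a: "a \<in> cube"
    \<comment> \<open>As \<open>s a\<close> has modulus at most 1, its square is at most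
      \<open>\<bar>s a\<bar>\<close>, which cancels a nonpositive \<open>s a\<close>.\<close>
    have sq: "(s a)\<^sup>2 \<le> \<bar>s a\<bar>"
      using s_le[OF a] mult_right_mono[of "\<bar>s a\<bar>" 1 "\<bar>s a\<bar>"]
      by (simp add: power2_eq_square flip: abs_mult)
    have "s a + (s a)\<^sup>2 \<le> (if a \<in> P then 0 else 2)"
      using sq s_le[OF a] P[of a] by (auto simp: s_def[symmetric])
    then have "(s a + (s a)\<^sup>2) * pmf \<mu> a \<le> (if a \<in> P then 0 else 2) * pmf \<mu> a"
      by (rule mult_right_mono) simp
    then show "(s a + (s a)\<^sup>2) * pmf \<mu> a \<le> 2 * (if a \<in> - P then pmf \<mu> a else 0)"
      by (simp split: if_splits)
  qed
  also have "\<dots> = 2 * measure_pmf.prob \<mu> (- P)"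
  proof -
    \<comment> \<open>Points off the cube carry no mass, so the complement can be cut down to a
      finite set.\<close>
    have "measure_pmf.prob \<mu> (- P) = measure_pmf.prob \<mu> (- P \<inter> cube)"
      using sub by (intro measure_prob_cong_0) (auto simp: set_pmf_iff)
    also have "\<dots> = sum (pmf \<mu>) (- P \<inter> cube)"
      using finite_cube by (intro measure_measure_pmf_finite) auto
    also have "\<dots> = (\<Sum>a\<in>cube. if a \<in> - P then pmf \<mu> a else 0)"
      by (subst Int_commute) (rule sum.inter_restrict[OF finite_cube])
    finally show ?thesis
      by (simp add: sum_distrib_left)
  qed
  also have "\<dots> \<le> 2 * \<gamma>"
    using \<mu>P measure_pmf.prob_compl[of P \<mu>] by (simp add: Compl_eq_Diff_UNIV)
  finally show ?thesis .
qed

text \<open>The square of a coordinate in {-1, 1} is 1, so the diagonal second moments are 1. Each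
  \<open>v i \<bullet> r\<close> is therefore a standard normal variable.\<close>

lemma approx_vector_assignment_norm:
  fixes v :: "'k::finite \<Rightarrow> real ^ 'n"
  assumes "approx_vector_assignment \<gamma> P v0 v"
  shows "norm (v i) = 1"
proof -
  obtain \<mu> :: "('k \<Rightarrow> real) pmf" where sub: "set_pmf \<mu> \<subseteq> cube"
    and m2: "\<And>i i'. v i \<bullet> v i' = (\<Sum>a\<in>cube. a i * a i' * pmf \<mu> a)"
    using assms unfolding approx_vector_assignment_def by blast
  have "v i \<bullet> v i = (\<Sum>a\<in>cube. pmf \<mu> a)"
    unfolding m2 by (intro sum.cong refl) (auto simp: cube_def dest!: spec[of _ i])
  also have "\<dots> = 1"
    using sub finite_cube by (intro sum_pmf_eq_1) auto
  finally show ?thesis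
    by (simp add: norm_eq_sqrt_inner)
qed

text \<open>Chernoff's bound at the rate \<open>1 / M\<close>, for which the hypothesis on \<open>W\<close> absorbs the
  variance of \<open>W \<bullet> r\<close>; tilting leaves the bound on the density of \<open>u \<bullet> r\<close> intact.\<close>

lemma std_gaussian_level_bound:
  fixes v0 W u :: "real ^ 'n"
  assumes u: "norm u = 1" and \<epsilon>: "\<epsilon> > 0" and M: "\<epsilon> \<le> M" "\<gamma> \<le> M"
    and W: "W \<bullet> v0 + (norm W)\<^sup>2 \<le> 2 * \<gamma>" and l: "l \<ge> 0"
  shows "emeasure std_gaussian
      {r. t \<le> W \<bullet> (v0 + sqrt \<epsilon> *\<^sub>R r) \<and> 0 \<le> u \<bullet> (v0 + sqrt \<epsilon> *\<^sub>R r) \<and> u \<bullet> (v0 + sqrt \<epsilon> *\<^sub>R r) \<le> l}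
    \<le> ennreal (exp (2 - t / M) * (l / sqrt \<epsilon>))" (is "emeasure _ ?E \<le> _")
proof -
  have M0: "M > 0"
    using \<epsilon> M by simp
  \<comment> \<open>This is the coefficient of \<open>r\<close> in
    \<open>W \<bullet> (v0 + sqrt \<epsilon> *\<^sub>R r) / M\<close>, hence the shift of the
    Gaussian; \<open>?c\<close> and \<open>?d\<close> are the bounds on \<open>u\<close> solved for
    \<open>u \<bullet> r\<close>.\<close>
  let ?a = "(sqrt \<epsilon> / M) *\<^sub>R W"
  let ?c = "- (u \<bullet> v0) / sqrt \<epsilon>" and ?d = "(l - u \<bullet> v0) / sqrt \<epsilon>"
  have dc: "?c \<le> ?d" "?d - ?c = l / sqrt \<epsilon>"
    using \<epsilon> l by (simp_all add: field_simps)
  have E: "?E \<in> sets std_gaussian"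
  proof -
    have "?E = {r \<in> space borel. t \<le> W \<bullet> (v0 + sqrt \<epsilon> *\<^sub>R r) \<and> 0 \<le> u \<bullet> (v0 + sqrt \<epsilon> *\<^sub>R r)
        \<and> u \<bullet> (v0 + sqrt \<epsilon> *\<^sub>R r) \<le> l}"
      by simp
    also have "\<dots> \<in> sets borel"
      by measurable
    finally show ?thesis
      by simp
  qed
  have "emeasure std_gaussian ?E = (\<integral>\<^sup>+ r. indicator ?E r \<partial>std_gaussian)"
    using E by simp
  \<comment> \<open>Exponential Markov inequality: on the event the exponent
    \<open>(W \<bullet> (v0 + sqrt \<epsilon> *\<^sub>R r) - t) / M\<close> is nonnegative.\<close>
  also have "\<dots> \<le> (\<integral>\<^sup>+ r. ennreal (exp ((W \<bullet> v0 - t) / M)) *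
      (ennreal (exp (?a \<bullet> r)) * indicator {r. ?c \<le> u \<bullet> r \<and> u \<bullet> r \<le> ?d} r) \<partial>std_gaussian)"
  proof (intro nn_integral_mono)
    fix r :: "real ^ 'n"
    show "indicator ?E r \<le> ennreal (exp ((W \<bullet> v0 - t) / M)) *
      (ennreal (exp (?a \<bullet> r)) * indicator {r. ?c \<le> u \<bullet> r \<and> u \<bullet> r \<le> ?d} r)"
    proof (cases "r \<in> ?E")
      case True
      then have "?c \<le> u \<bullet> r" "u \<bullet> r \<le> ?d"
        using \<epsilon> by (auto simp: inner_add_right field_simps)
      moreover have "0 \<le> (W \<bullet> v0 - t) / M + ?a \<bullet> r"
      proof -
        have "(W \<bullet> v0 - t) / M + ?a \<bullet> r = (W \<bullet> (v0 + sqrt \<epsilon> *\<^sub>R r) - t) / M"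
          by (simp add: inner_add_right add_divide_distrib diff_divide_distrib)
        then show ?thesis
          using True M0 by simp
      qed
      then have "1 \<le> exp ((W \<bullet> v0 - t) / M) * exp (?a \<bullet> r)"
        by (simp flip: exp_add)
      ultimately show ?thesis
        using True by (simp flip: ennreal_mult' ennreal_1)
    qed simp
  qed
  also have "\<dots> = ennreal (exp ((W \<bullet> v0 - t) / M)) * (\<integral>\<^sup>+ r. ennreal (exp (?a \<bullet> r)) *
      indicator {r. ?c \<le> u \<bullet> r \<and> u \<bullet> r \<le> ?d} r \<partial>std_gaussian)"
    by (rule nn_integral_cmult) measurable
  also have "\<dots> \<le> ennreal (exp ((W \<bullet> v0 - t) / M)) * ennreal (exp ((norm ?a)\<^sup>2 / 2) * (?d - ?c))"
    by (intro mult_left_mono std_gaussian_exp_strip u dc) simp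
  also have "\<dots> = ennreal (exp ((W \<bullet> v0 - t) / M + (norm ?a)\<^sup>2 / 2) * (l / sqrt \<epsilon>))"
    unfolding dc(2) by (simp add: exp_add mult.assoc flip: ennreal_mult')
  also have "\<dots> \<le> ennreal (exp (2 - t / M) * (l / sqrt \<epsilon>))"
  proof -
    \<comment> \<open>From \<open>\<epsilon> \<le> M\<close> the variance term is at most
      \<open>(norm W)\<^sup>2 / M\<close>. Together with the mean it is bounded by
      \<open>2 * \<gamma> / M \<le> 2\<close>, the source of the 2 in the exponent.\<close>
    have "(norm ?a)\<^sup>2 = \<epsilon> * (norm W)\<^sup>2 / M\<^sup>2"
      using \<epsilon> by (simp add: power_mult_distrib power_divide)
    also have "\<dots> \<le> M * (norm W)\<^sup>2 / M\<^sup>2"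
      using M by (intro divide_right_mono mult_right_mono) auto
    finally have "(norm ?a)\<^sup>2 \<le> (norm W)\<^sup>2 / M"
      using M0 by (simp add: power2_eq_square)
    moreover have "(norm W)\<^sup>2 / M \<ge> 0"
      using M0 by simp
    moreover have "(W \<bullet> v0 + (norm W)\<^sup>2) / M \<le> 2"
      using W M M0 by (simp add: divide_le_eq)
    ultimately have "(W \<bullet> v0 - t) / M + (norm ?a)\<^sup>2 / 2 \<le> 2 - t / M"
      by (simp add: add_divide_distrib diff_divide_distrib)
    then show ?thesis
      using \<epsilon> l by (intro ennreal_leI mult_right_mono) auto
  qed
  finally show ?thesis .
qed

text \<open>With \<open>e \<ge> 5/2\<close>, \<open>e\<^sup>2 \<le> 9\<close> and
  \<open>n + 1 \<le> 2 ^ n\<close> the terms are dominated by \<open>9 * (4/5) ^ n\<close>, whose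
  sum is 45.\<close>

lemma suminf_weighted_exp_le:
  "(\<Sum>n. ennreal (exp (2 - real n) * (real n + 1))) \<le> 600"
proof -
  have e1: "exp (1::real) \<ge> 5/2"
    using exp_lower_Taylor_quadratic[of 1] by simp
  have e2: "exp (2::real) \<le> 9"
    using exp_le power_mono[of "exp (1::real)" 3 2] by (simp flip: exp_of_nat_mult)
  have "exp (2 - real n) * (real n + 1) \<le> 9 * (4/5) ^ n" for n
  proof -
    have "real n + 1 \<le> 2 ^ n"
      by (induction n) auto
    moreover have "exp (- real n) \<le> (2/5) ^ n"
    proof -
      have "exp (- real n) = (inverse (exp 1)) ^ n"
        by (simp add: exp_minus exp_of_nat_mult[of n 1, simplified] power_inverse)
      also have "\<dots> \<le> (2/5) ^ n"
        using le_imp_inverse_le[OF e1] by (intro power_mono) auto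
      finally show ?thesis .
    qed
    ultimately have "exp 2 * (exp (- real n) * (real n + 1)) \<le> 9 * ((2/5) ^ n * 2 ^ n)"
      using e2 by (intro mult_mono) auto
    moreover have "exp (2 - real n) = exp 2 * exp (- real n)"
      by (simp flip: exp_add)
    moreover have "(2/5) ^ n * 2 ^ n = (4/5 :: real) ^ n"
      by (simp flip: power_mult_distrib)
    ultimately show ?thesis
      by (simp add: mult.assoc)
  qed
  then have "(\<Sum>n. ennreal (exp (2 - real n) * (real n + 1))) \<le> (\<Sum>n. ennreal (9 * (4/5) ^ n))"
    by (intro suminf_le ennreal_leI) auto
  also have "\<dots> = ennreal (\<Sum>n. 9 * (4/5) ^ n)"
    by (intro suminf_ennreal2) (auto intro!: summable_mult summable_geometric)
  also have "(\<Sum>n. 9 * (4/5) ^ n) = (45 :: real)"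
    by (subst suminf_mult) (auto simp: suminf_geometric intro!: summable_geometric)
  finally show ?thesis
    by (rule order_trans) simp
qed

theorem theorem4p4:
  fixes P Q :: "('k::finite \<Rightarrow> real) set"
    and v0 :: "real ^ 'n" and v :: "'k \<Rightarrow> real ^ 'n"
    and \<gamma> \<epsilon> :: real and b :: "'k \<Rightarrow> real"
  assumes "P \<subseteq> Q" and "Q \<subseteq> cube"
    and "maj_subset_pol P Q"
    and "approx_vector_assignment \<gamma> P v0 v"
    and "\<epsilon> > 0"
    and "b \<in> cube - Q"
  shows "cmm_prob \<epsilon> v0 v b \<le> 600 * real CARD('k) * (max \<epsilon> \<gamma> / sqrt \<epsilon>)"
proof -
  let ?k = "real CARD('k)"
  define M where "M = max \<epsilon> \<gamma>"
  have M: "\<epsilon> \<le> M" "\<gamma> \<le> M" "M > 0"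
    using \<open>\<epsilon> > 0\<close> by (auto simp: M_def)
  have b: "b i = 1 \<or> b i = -1" for i
    using \<open>b \<in> cube - Q\<close> by (auto simp: cube_def)
  have "P \<subseteq> cube"
    using \<open>P \<subseteq> Q\<close> \<open>Q \<subseteq> cube\<close> by blast
  then obtain w where w: "\<And>i. w i \<ge> 0" "(\<Sum>i\<in>UNIV. w i) = 1"
    and wP: "\<And>a. a \<in> P \<Longrightarrow> (\<Sum>i\<in>UNIV. w i * (b i * a i)) \<le> 0"
    using separating_weights[OF \<open>maj_subset_pol P Q\<close> \<open>b \<in> cube - Q\<close>] by blast
  \<comment> \<open>The weights average \<open>1 / ?k\<close>, so one of them reaches it. Here
    \<open>k\<close> is that index, while \<open>?k\<close> is the number of coordinates.\<close>
  obtain k where k: "w k \<ge> 1 / ?k"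
  proof (rule ccontr)
    assume "\<not> thesis"
    then have "w i < 1 / ?k" for i
      using that by (meson not_le)
    then have "(\<Sum>i\<in>UNIV. w i) < (\<Sum>i::'k\<in>UNIV. 1 / ?k)"
      by (intro sum_strict_mono) auto
    then show False
      using w by simp
  qed
  define W where "W = (\<Sum>i\<in>UNIV. (w i * b i) *\<^sub>R v i)"
  define u where "u = b k *\<^sub>R v k"
  have W: "W \<bullet> v0 + (norm W)\<^sup>2 \<le> 2 * \<gamma>"
    unfolding W_def
  proof (rule approx_vector_assignment_functional[OF \<open>approx_vector_assignment \<gamma> P v0 v\<close>])
    have "\<bar>w i * b i\<bar> = w i" for i
      using w(1)[of i] b[of i] by auto
    then show "(\<Sum>i\<in>UNIV. \<bar>w i * b i\<bar>) \<le> 1"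
      using w(2) by simp
    show "(\<Sum>i\<in>UNIV. w i * b i * a i) \<le> 0" if "a \<in> P" for a
      using wP[OF that] by (simp add: mult.assoc)
  qed
  have u: "norm u = 1"
    using approx_vector_assignment_norm[OF \<open>approx_vector_assignment \<gamma> P v0 v\<close>, of k] b[of k]
    by (auto simp: u_def)
  \<comment> \<open>Only the lower end of level \<open>n\<close> is imposed on \<open>W\<close>; its
    upper end \<open>(n + 1) * M\<close> enters through the bound on \<open>u\<close>.\<close>
  define E where "E n = {r. real n * M \<le> W \<bullet> (v0 + sqrt \<epsilon> *\<^sub>R r) \<and> 0 \<le> u \<bullet> (v0 + sqrt \<epsilon> *\<^sub>R r)
    \<and> u \<bullet> (v0 + sqrt \<epsilon> *\<^sub>R r) \<le> ?k * (real n + 1) * M}" for n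
  have "E n \<in> sets borel" for n
  proof -
    have "E n = {r \<in> space borel. real n * M \<le> W \<bullet> (v0 + sqrt \<epsilon> *\<^sub>R r) \<and> 0 \<le> u \<bullet> (v0 + sqrt \<epsilon> *\<^sub>R r)
        \<and> u \<bullet> (v0 + sqrt \<epsilon> *\<^sub>R r) \<le> ?k * (real n + 1) * M}"
      by (simp add: E_def)
    also have "\<dots> \<in> sets borel"
      by measurable
    finally show ?thesis .
  qed
  then have E_sets: "range E \<subseteq> sets std_gaussian"
    by auto
  have E_le: "emeasure std_gaussian (E n)
      \<le> ennreal (?k * (M / sqrt \<epsilon>)) * ennreal (exp (2 - real n) * (real n + 1))" for n
  proof -
    have "emeasure std_gaussian (E n)
        \<le> ennreal (exp (2 - real n * M / M) * (?k * (real n + 1) * M / sqrt \<epsilon>))"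
      unfolding E_def using M
      by (intro std_gaussian_level_bound[OF u \<open>\<epsilon> > 0\<close> M(1,2) W]) auto
    also have "exp (2 - real n * M / M) * (?k * (real n + 1) * M / sqrt \<epsilon>)
        = ?k * (M / sqrt \<epsilon>) * (exp (2 - real n) * (real n + 1))"
      using M(3) by simp
    also have "ennreal \<dots> = ennreal (?k * (M / sqrt \<epsilon>)) * ennreal (exp (2 - real n) * (real n + 1))"
      by (rule ennreal_mult) (use M(3) \<open>\<epsilon> > 0\<close> in auto)
    finally show ?thesis .
  qed
  have cover: "{r. cmm_round \<epsilon> v0 v r = b} \<subseteq> (\<Union>n. E n)"
  proof clarify
    fix r assume r: "b = cmm_round \<epsilon> v0 v r"
    let ?g = "v0 + sqrt \<epsilon> *\<^sub>R r"
    \<comment> \<open>A tie is rounded to 1, so these products are only weakly nonnegative, which is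
      enough.\<close>
    have nonneg: "0 \<le> b i * (v i \<bullet> ?g)" for i
      by (simp add: r cmm_round_def)
    have Wg: "W \<bullet> ?g = (\<Sum>i\<in>UNIV. w i * (b i * (v i \<bullet> ?g)))"
      by (simp add: W_def inner_sum_left mult.assoc)
    have "w k * (b k * (v k \<bullet> ?g)) \<le> W \<bullet> ?g"
      unfolding Wg using nonneg w(1) by (intro member_le_sum) auto
    moreover have "1 / ?k * (u \<bullet> ?g) \<le> w k * (b k * (v k \<bullet> ?g))"
      using mult_right_mono[OF k nonneg[of k]] by (simp add: u_def)
    ultimately have "1 / ?k * (u \<bullet> ?g) \<le> W \<bullet> ?g"
      by (rule order_trans[rotated])
    then have u_le: "u \<bullet> ?g \<le> ?k * (W \<bullet> ?g)"
      by (simp add: divide_le_eq mult.commute)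
    \<comment> \<open>The quotient is nonnegative, being a nonnegative average divided by
      \<open>M\<close>, so \<open>nat\<close> does not truncate the floor.\<close>
    define n where "n = nat \<lfloor>(W \<bullet> ?g) / M\<rfloor>"
    have "0 \<le> (W \<bullet> ?g) / M"
      unfolding Wg using nonneg w(1) M(3) by (intro divide_nonneg_pos sum_nonneg) auto
    then have "real n \<le> (W \<bullet> ?g) / M" "(W \<bullet> ?g) / M \<le> real n + 1"
      unfolding n_def by linarith+
    then have n: "real n * M \<le> W \<bullet> ?g" "W \<bullet> ?g \<le> (real n + 1) * M"
      using M(3) by (simp_all add: le_divide_eq divide_le_eq)
    have "u \<bullet> ?g \<le> ?k * ((real n + 1) * M)"
      using u_le by (rule order_trans) (intro mult_left_mono n(2), simp)
    then have "r \<in> E n"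
      using n(1) nonneg[of k] by (simp add: E_def u_def mult.assoc)
    then show "r \<in> (\<Union>n. E n)"
      by blast
  qed
  interpret prob_space "std_gaussian :: (real ^ 'n) measure"
    by (rule prob_space_std_gaussian)
  have "ennreal (cmm_prob \<epsilon> v0 v b) = emeasure std_gaussian {r. cmm_round \<epsilon> v0 v r = b}"
    by (simp add: cmm_prob_def emeasure_eq_measure)
  also have "\<dots> \<le> emeasure std_gaussian (\<Union>n. E n)"
    using cover E_sets by (intro emeasure_mono) auto
  also have "\<dots> \<le> (\<Sum>n. emeasure std_gaussian (E n))"
    using E_sets by (rule emeasure_subadditive_countably)
  also have "\<dots> \<le> (\<Sum>n. ennreal (?k * (M / sqrt \<epsilon>)) * ennreal (exp (2 - real n) * (real n + 1)))"
    using E_le by (intro suminf_le) auto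
  also have "\<dots> = ennreal (?k * (M / sqrt \<epsilon>)) * (\<Sum>n. ennreal (exp (2 - real n) * (real n + 1)))"
    by (rule ennreal_suminf_cmult)
  also have "\<dots> \<le> ennreal (?k * (M / sqrt \<epsilon>)) * ennreal 600"
    using suminf_weighted_exp_le by (intro mult_left_mono) auto
  also have "\<dots> = ennreal (?k * (M / sqrt \<epsilon>) * 600)"
    using M(3) \<open>\<epsilon> > 0\<close> by (intro ennreal_mult[symmetric]) auto
  finally have "cmm_prob \<epsilon> v0 v b \<le> ?k * (M / sqrt \<epsilon>) * 600"
    using M(3) \<open>\<epsilon> > 0\<close> by (subst (asm) ennreal_le_iff) auto
  then show ?thesis
    by (simp add: M_def mult_ac)
qed

end
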